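(* Let $w$ be a weight function on the finite group $G$ and let $H$ be a subgroup of $G$. A necessary and sufficient condition for the random walk on $G$ driven by $w$ to lump on the double cosets $H\backslash G/H$ is that $w(xH) = w(yH)$ whenever $x, y \in G$ satisfy $HxH = HyH$.
   Context: A weight function on a finite group $G$ is a function $w : G \to \mathbb{R}_{\ge 0}$ with $w(G) > 0$, where for $S \subseteq G$ we write $w(S) = \sum_{s \in S} w(s)$. The random walk on $G$ driven by $w$ is the time-homogeneous Markov chain on $G$ in which the probability of a transition from $x$ to $y$ is $w(x^{-1}y)/w(G)$ (steps are by right multiplication). The random walk lumps on the double cosets $H\backslash G/H$ if it induces a time-homogeneous Markov chain on $H\backslash G/H$ under the quotient map $g \mapsto HgH$, in the strong sense: for every initial distribution of the walk on $G$, the process of double cosets visited is a time-homogeneous Markov chain, with transition probabilities not depending on the initial distribution. *)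

theory Defs
  imports "HOL-Probability.Probability" "HOL-Algebra.Coset"
begin

definition stochastic_matrix :: "'s set \<Rightarrow> ('s \<Rightarrow> 's \<Rightarrow> real) \<Rightarrow> bool" where
  "stochastic_matrix S P \<longleftrightarrow>
     finite S \<and> (\<forall>x\<in>S. (\<forall>y\<in>S. 0 \<le> P x y) \<and> (\<Sum>y\<in>S. P x y) = 1)"

definition markov_chain ::
  "'w measure \<Rightarrow> (nat \<Rightarrow> 'w \<Rightarrow> 's) \<Rightarrow> 's set \<Rightarrow> ('s \<Rightarrow> 's \<Rightarrow> real) \<Rightarrow> bool" where
  "markov_chain M X S P \<longleftrightarrow>
     prob_space M \<and>
     stochastic_matrix S P \<and>
     (\<forall>n. X n \<in> measurable M (count_space S)) \<and>
     (\<forall>n x. (\<forall>i\<le>Suc n. x i \<in> S) \<longrightarrow>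
        \<P>(\<omega> in M. \<forall>i\<le>n. X i \<omega> = x i) > 0 \<longrightarrow>
        \<P>(\<omega> in M. X (Suc n) \<omega> = x (Suc n) \<bar> \<forall>i\<le>n. X i \<omega> = x i) = P (x n) (x (Suc n)))"

(* The initial law is left free in markov_chain, so quantifying over all chains (M, X) with
   transition matrix P is quantifying over all initial distributions; that Q is chosen first
   says that it does not depend on them. Every law of a process in 's is realised on the
   path space nat \<Rightarrow> 's, so fixing this type of sample points loses nothing. *)
definition lumps :: "'s set \<Rightarrow> ('s \<Rightarrow> 's \<Rightarrow> real) \<Rightarrow> ('s \<Rightarrow> 't) \<Rightarrow> bool" where
  "lumps S P f \<longleftrightarrow>
     (\<exists>Q. \<forall>(M :: (nat \<Rightarrow> 's) measure) X.
        markov_chain M X S P \<longrightarrow> markov_chain M (\<lambda>n \<omega>. f (X n \<omega>)) (f ` S) Q)"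

definition weight_function :: "('a, 'b) monoid_scheme \<Rightarrow> ('a \<Rightarrow> real) \<Rightarrow> bool" where
  "weight_function G w \<longleftrightarrow> (\<forall>g\<in>carrier G. 0 \<le> w g) \<and> 0 < sum w (carrier G)"

definition walk_matrix :: "('a, 'b) monoid_scheme \<Rightarrow> ('a \<Rightarrow> real) \<Rightarrow> 'a \<Rightarrow> 'a \<Rightarrow> real" where
  "walk_matrix G w x y = w (inv\<^bsub>G\<^esub> x \<otimes>\<^bsub>G\<^esub> y) / sum w (carrier G)"

definition double_coset :: "('a, 'b) monoid_scheme \<Rightarrow> 'a set \<Rightarrow> 'a \<Rightarrow> 'a set" where
  "double_coset G H g = H <#>\<^bsub>G\<^esub> (g <#\<^bsub>G\<^esub> H)"

definition lumps_on_double_cosets ::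
  "('a, 'b) monoid_scheme \<Rightarrow> ('a \<Rightarrow> real) \<Rightarrow> 'a set \<Rightarrow> bool" where
  "lumps_on_double_cosets G w H \<longleftrightarrow> lumps (carrier G) (walk_matrix G w) (double_coset G H)"

end

(* A chain lumps along f as soon as the probability of jumping into a class depends only on the
   class of the current state. For the walk, replacing x by h x k changes the probability of
   jumping from x into D = HgH from w(x^-1 D) to w(k^-1 x^-1 D); as D is right H-invariant, both
   sets are unions of left cosets yH, resp. k^-1 yH, which have equal weights by the criterion.
   Conversely, the trivial double coset H already suffices: the walk started at x is in H after
   one step with probability w(x^-1 H)/w(G), so lumping forces this to depend only on HxH. *)
theory Submission
  imports Defs
begin

section \<open>Finite histories of a chain, and a sufficient condition for lumping\<close>

lemma sets_markov_chain_eq: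
  assumes "markov_chain M X S P"
  shows "{\<omega> \<in> space M. X i \<omega> = c} \<in> sets M"
    and "{\<omega> \<in> space M. \<forall>i\<le>n. X i \<omega> = p i} \<in> sets M"
proof -
  have X: "X i \<in> measurable M (count_space S)" for i
    using assms by (simp add: markov_chain_def)
  show ev: "{\<omega> \<in> space M. X i \<omega> = c} \<in> sets M" for i c
  proof -
    \<comment> \<open>The value \<open>c\<close> may lie outside \<open>S\<close>, hence the
      intersection with \<open>S\<close>.\<close>
    have "{\<omega> \<in> space M. X i \<omega> = c} = X i -` ({c} \<inter> S) \<inter> space M"
      using measurable_space[OF X] by auto
    then show ?thesis using measurable_sets[OF X, of "{c} \<inter> S" i] by simp
  qed
  show "{\<omega> \<in> space M. \<forall>i\<le>n. X i \<omega> = p i} \<in> sets M"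
    using sets.sets_Collect_finite_All'[of "{..n}" M "\<lambda>i \<omega>. X i \<omega> = p i"] ev by auto
qed

text \<open>The Markov property with its denominator cleared. In this form it also covers histories
  of probability 0, so it can be summed over paths without case distinctions.\<close>

lemma markov_chain_prob_path_Suc:
  assumes chain: "markov_chain M X S P" and x: "\<And>i. i \<le> Suc n \<Longrightarrow> x i \<in> S"
  shows "\<P>(\<omega> in M. \<forall>i\<le>Suc n. X i \<omega> = x i) =
    \<P>(\<omega> in M. \<forall>i\<le>n. X i \<omega> = x i) * P (x n) (x (Suc n))"
proof -
  interpret prob_space M using chain by (simp add: markov_chain_def)
  let ?B = "{\<omega> \<in> space M. \<forall>i\<le>n. X i \<omega> = x i}"
  let ?A = "{\<omega> \<in> space M. \<forall>i\<le>Suc n. X i \<omega> = x i}"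
  have evB: "?B \<in> sets M" by (rule sets_markov_chain_eq[OF chain])
  have A: "?A = {\<omega> \<in> space M. X (Suc n) \<omega> = x (Suc n) \<and> (\<forall>i\<le>n. X i \<omega> = x i)}"
    by (auto simp: le_Suc_eq)
  show ?thesis
  proof (cases "prob ?B > 0")
    case True
    then have "\<P>(\<omega> in M. X (Suc n) \<omega> = x (Suc n) \<bar> \<forall>i\<le>n. X i \<omega> = x i) = P (x n) (x (Suc n))"
      using chain x unfolding markov_chain_def by blast
    with True show ?thesis unfolding A by (simp add: cond_prob_def field_simps)
  next
    \<comment> \<open>A null history makes the longer path null as well, so both sides
      vanish.\<close>
    case False
    have "prob ?A \<le> prob ?B" by (rule finite_measure_mono[OF _ evB]) auto
    with False show ?thesis
      by (metis (no_types, lifting) measure_nonneg mult_zero_left order_antisym not_le order_trans)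
  qed
qed

lemma (in finite_measure) measure_partition:
  assumes "finite I" and "\<And>i. i \<in> I \<Longrightarrow> {\<omega> \<in> space M. Y \<omega> = i} \<in> sets M"
  shows "measure M {\<omega> \<in> space M. Y \<omega> \<in> I} = (\<Sum>i\<in>I. measure M {\<omega> \<in> space M. Y \<omega> = i})"
proof -
  have "{\<omega> \<in> space M. Y \<omega> \<in> I} = (\<Union>i\<in>I. {\<omega> \<in> space M. Y \<omega> = i})" by auto
  then show ?thesis
    using assms by (auto simp: disjoint_family_on_def intro!: finite_measure_finite_Union)
qed

text \<open>Summing the product formula over the histories in \<open>A\<close> and the next states
  in \<open>B\<close> lets the common factor \<open>q\<close> be pulled out. Histories are encoded
  as functions restricted to \<open>{..n}\<close>, so that there are only finitely many and distinct
  ones give disjoint events.\<close>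

lemma markov_chain_prob_history_Suc:
  assumes chain: "markov_chain M X S P"
    and A: "A \<subseteq> {..n} \<rightarrow>\<^sub>E S" and B: "B \<subseteq> S"
    and q: "\<And>p. p \<in> A \<Longrightarrow> (\<Sum>y\<in>B. P (p n) y) = q"
  shows "\<P>(\<omega> in M. restrict (\<lambda>i. X i \<omega>) {..n} \<in> A \<and> X (Suc n) \<omega> \<in> B) =
    \<P>(\<omega> in M. restrict (\<lambda>i. X i \<omega>) {..n} \<in> A) * q"
proof -
  interpret prob_space M using chain by (simp add: markov_chain_def)
  note evp = sets_markov_chain_eq(2)[OF chain]
  have S: "finite S" using chain by (simp add: markov_chain_def stochastic_matrix_def)
  have finA: "finite A" using A S by (auto intro: finite_subset finite_PiE)
  have finB: "finite B" using B S by (auto intro: finite_subset)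
  let ?h = "\<lambda>\<omega>. restrict (\<lambda>i. X i \<omega>) {..n}"
  \<comment> \<open>Both functions take the default value beyond \<open>n\<close>, so agreement up
    to time \<open>n\<close> is already equality.\<close>
  have hist: "?h \<omega> = p \<longleftrightarrow> (\<forall>i\<le>n. X i \<omega> = p i)" if "p \<in> A" for p \<omega>
  proof
    assume "\<forall>i\<le>n. X i \<omega> = p i"
    moreover have "p \<in> extensional {..n}" using that A by (auto simp: PiE_def)
    ultimately show "?h \<omega> = p" by (intro extensionalityI[of _ "{..n}"]) auto
  qed auto
  have set_hist: "{\<omega> \<in> space M. ?h \<omega> = p} = {\<omega> \<in> space M. \<forall>i\<le>n. X i \<omega> = p i}"
    if "p \<in> A" for p
    using hist[OF that] by blast
  have "prob {\<omega> \<in> space M. ?h \<omega> \<in> A} = (\<Sum>p\<in>A. prob {\<omega> \<in> space M. ?h \<omega> = p})"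
    by (rule measure_partition[OF finA]) (simp only: set_hist evp)
  also have "\<dots> = (\<Sum>p\<in>A. prob {\<omega> \<in> space M. \<forall>i\<le>n. X i \<omega> = p i})"
    by (rule sum.cong[OF refl]) (simp only: set_hist)
  finally have hA: "prob {\<omega> \<in> space M. ?h \<omega> \<in> A} =
      (\<Sum>p\<in>A. prob {\<omega> \<in> space M. \<forall>i\<le>n. X i \<omega> = p i})" .
  \<comment> \<open>A history followed by a next state is again a path, one step longer, to which
    the product formula applies.\<close>
  have pair: "{\<omega> \<in> space M. (?h \<omega>, X (Suc n) \<omega>) = (p, y)} =
      {\<omega> \<in> space M. \<forall>i\<le>Suc n. X i \<omega> = (p(Suc n := y)) i}" if "p \<in> A" for p y
    using that by (auto simp: hist le_Suc_eq)
  have step: "prob {\<omega> \<in> space M. (?h \<omega>, X (Suc n) \<omega>) = (p, y)} =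
      prob {\<omega> \<in> space M. \<forall>i\<le>n. X i \<omega> = p i} * P (p n) y" if "p \<in> A" "y \<in> B" for p y
  proof -
    have "(p(Suc n := y)) i \<in> S" if "i \<le> Suc n" for i
      using that \<open>p \<in> A\<close> \<open>y \<in> B\<close> A B by (auto simp: le_Suc_eq)
    from markov_chain_prob_path_Suc[OF chain, of n "p(Suc n := y)", OF this]
    show ?thesis unfolding pair[OF \<open>p \<in> A\<close>] by simp
  qed
  have "prob {\<omega> \<in> space M. ?h \<omega> \<in> A \<and> X (Suc n) \<omega> \<in> B} =
      prob {\<omega> \<in> space M. (?h \<omega>, X (Suc n) \<omega>) \<in> A \<times> B}" by simp
  also have "\<dots> = (\<Sum>z\<in>A \<times> B. prob {\<omega> \<in> space M. (?h \<omega>, X (Suc n) \<omega>) = z})"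
  proof (rule measure_partition)
    fix z assume "z \<in> A \<times> B"
    then obtain p y where "z = (p, y)" "p \<in> A" by auto
    then show "{\<omega> \<in> space M. (?h \<omega>, X (Suc n) \<omega>) = z} \<in> sets M"
      by (simp only: pair evp)
  qed (use finA finB in simp)
  also have "\<dots> = (\<Sum>p\<in>A. \<Sum>y\<in>B. prob {\<omega> \<in> space M. (?h \<omega>, X (Suc n) \<omega>) = (p, y)})"
    by (simp only: sum.cartesian_product split_def prod.collapse)
  also have "\<dots> = (\<Sum>p\<in>A. \<Sum>y\<in>B. prob {\<omega> \<in> space M. \<forall>i\<le>n. X i \<omega> = p i} * P (p n) y)"
    by (intro sum.cong refl step)
  also have "\<dots> = (\<Sum>p\<in>A. prob {\<omega> \<in> space M. \<forall>i\<le>n. X i \<omega> = p i} * q)"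
    by (intro sum.cong refl) (simp only: sum_distrib_left[symmetric] q)
  finally show ?thesis by (simp add: hA sum_distrib_right)
qed

text \<open>A past of the image process is a set of pasts of the chain, all ending in one fibre of
  \<open>f\<close>. From every state of that fibre the chance of jumping into the next fibre is the
  same, so conditioning on the whole set yields that common value.\<close>

lemma lumps_if_class_sums_eq:
  assumes sums: "\<And>x x' t. \<lbrakk>x \<in> S; x' \<in> S; f x = f x'; t \<in> f ` S\<rbrakk> \<Longrightarrow>
      (\<Sum>y\<in>{y \<in> S. f y = t}. P x y) = (\<Sum>y\<in>{y \<in> S. f y = t}. P x' y)"
  shows "lumps S P f"
proof -
  \<comment> \<open>Evaluated at a chosen representative of the class; by \<open>sums\<close> the
    choice does not matter. Only \<open>P\<close>, \<open>S\<close> and \<open>f\<close> enter, so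
    one \<open>Q\<close> serves all chains.\<close>
  define Q where "Q = (\<lambda>s t. \<Sum>y\<in>{y \<in> S. f y = t}. P (inv_into S f s) y)"
  have "markov_chain M (\<lambda>n \<omega>. f (X n \<omega>)) (f ` S) Q"
    if chain: "markov_chain M X S P" for M :: "(nat \<Rightarrow> 'a) measure" and X
  proof -
    from chain interpret prob_space M by (simp add: markov_chain_def)
    have X: "X i \<in> measurable M (count_space S)" for i
      using chain by (simp add: markov_chain_def)
    have S: "finite S" and P: "\<And>x y. x \<in> S \<Longrightarrow> y \<in> S \<Longrightarrow> 0 \<le> P x y" "\<And>x. x \<in> S \<Longrightarrow> sum (P x) S = 1"
      using chain by (auto simp: markov_chain_def stochastic_matrix_def)
    show ?thesis
      unfolding markov_chain_def
    proof (intro conjI allI impI)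
      show "prob_space M" by (rule prob_space_axioms)
      show "stochastic_matrix (f ` S) Q"
        unfolding stochastic_matrix_def Q_def
      proof (intro conjI ballI)
        fix s assume "s \<in> f ` S"
        then have s: "inv_into S f s \<in> S" by (rule inv_into_into)
        \<comment> \<open>The fibres of \<open>f\<close> partition \<open>S\<close>, so the class
          sums add up to a full row sum of \<open>P\<close>.\<close>
        show "(\<Sum>t\<in>f ` S. \<Sum>y\<in>{y \<in> S. f y = t}. P (inv_into S f s) y) = 1"
          using sum.image_gen[OF S, of "P (inv_into S f s)" f] P(2)[OF s] by simp
        show "0 \<le> (\<Sum>y\<in>{y \<in> S. f y = t}. P (inv_into S f s) y)" for t
          using P(1)[OF s] by (auto intro: sum_nonneg)
      qed (use S in simp)
      show "(\<lambda>\<omega>. f (X n \<omega>)) \<in> measurable M (count_space (f ` S))" for n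
        by (rule measurable_compose[OF X]) simp
    next
      fix n and t :: "nat \<Rightarrow> 'b"
      assume t: "\<forall>i\<le>Suc n. t i \<in> f ` S" and pos: "\<P>(\<omega> in M. \<forall>i\<le>n. f (X i \<omega>) = t i) > 0"
      let ?h = "\<lambda>\<omega>. restrict (\<lambda>i. X i \<omega>) {..n}"
      \<comment> \<open>The histories of the chain lying over the class history \<open>t\<close>.
        Each ends in the fibre of \<open>t n\<close>, which is what makes the next-step sum constant
        on \<open>?A\<close>.\<close>
      let ?A = "{p \<in> {..n} \<rightarrow>\<^sub>E S. \<forall>i\<le>n. f (p i) = t i}"
      let ?B = "{y \<in> S. f y = t (Suc n)}"
      have XS: "X i \<omega> \<in> S" if "\<omega> \<in> space M" for i \<omega>
        using measurable_space[OF X that] by simp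
      have A: "{\<omega> \<in> space M. \<forall>i\<le>n. f (X i \<omega>) = t i} = {\<omega> \<in> space M. ?h \<omega> \<in> ?A}"
        using XS by auto
      have AB: "{\<omega> \<in> space M. f (X (Suc n) \<omega>) = t (Suc n) \<and> (\<forall>i\<le>n. f (X i \<omega>) = t i)} =
          {\<omega> \<in> space M. ?h \<omega> \<in> ?A \<and> X (Suc n) \<omega> \<in> ?B}"
        using XS by auto
      have "prob {\<omega> \<in> space M. ?h \<omega> \<in> ?A \<and> X (Suc n) \<omega> \<in> ?B} =
          prob {\<omega> \<in> space M. ?h \<omega> \<in> ?A} * Q (t n) (t (Suc n))"
      proof (rule markov_chain_prob_history_Suc[OF chain])
        fix p assume p: "p \<in> ?A"
        have "t n \<in> f ` S" using t by simp
        then show "(\<Sum>y\<in>?B. P (p n) y) = Q (t n) (t (Suc n))"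
          unfolding Q_def using p t by (intro sums) (auto simp: inv_into_into f_inv_into_f)
      qed auto
      then show "\<P>(\<omega> in M. f (X (Suc n) \<omega>) = t (Suc n) \<bar> \<forall>i\<le>n. f (X i \<omega>) = t i) =
          Q (t n) (t (Suc n))"
        using pos unfolding cond_prob_def A AB by simp
    qed
  qed
  then show ?thesis unfolding lumps_def by blast
qed

section \<open>A realisation of the walk from a prescribed starting point\<close>

primrec walk_path :: "('a, 'b) monoid_scheme \<Rightarrow> 'a \<Rightarrow> (nat \<Rightarrow> 'a) \<Rightarrow> nat \<Rightarrow> 'a" where
  "walk_path G a s 0 = a"
| "walk_path G a s (Suc n) = walk_path G a s n \<otimes>\<^bsub>G\<^esub> s n"

text \<open>The sample points are sequences of increments, not of positions: the coordinates are
  independent with law w/w(G). The sample type is the one over which \<open>lumps\<close>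
  quantifies.\<close>

definition steps_measure :: "('a, 'b) monoid_scheme \<Rightarrow> ('a \<Rightarrow> real) \<Rightarrow> (nat \<Rightarrow> 'a) measure" where
  "steps_measure G w =
     (\<Pi>\<^sub>M i\<in>UNIV. point_measure (carrier G) (\<lambda>g. ennreal (w g / sum w (carrier G))))"

context group
begin

lemma prob_space_steps:
  assumes "finite (carrier G)" "weight_function G w"
  shows "prob_space (point_measure (carrier G) (\<lambda>g. ennreal (w g / sum w (carrier G))))"
proof (rule prob_spaceI)
  have "(\<Sum>g\<in>carrier G. w g / sum w (carrier G)) = 1"
    using assms by (simp add: weight_function_def sum_divide_distrib[symmetric])
  moreover have "0 \<le> w g / sum w (carrier G)" if "g \<in> carrier G" for g
    using assms that by (simp add: weight_function_def)
  ultimately show "emeasure (point_measure (carrier G) (\<lambda>g. ennreal (w g / sum w (carrier G))))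
      (space (point_measure (carrier G) (\<lambda>g. ennreal (w g / sum w (carrier G))))) = 1"
    using assms(1) by (simp add: space_point_measure emeasure_point_measure_finite)
qed

lemma stochastic_walk_matrix:
  assumes "finite (carrier G)" "weight_function G w"
  shows "stochastic_matrix (carrier G) (walk_matrix G w)"
proof -
  \<comment> \<open>Left translation permutes the group, so each row of the matrix rearranges the
    same weights.\<close>
  have "(\<Sum>y\<in>carrier G. w (inv x \<otimes> y)) = sum w (carrier G)" if "x \<in> carrier G" for x
    by (rule sum.reindex_bij_witness[of _ "\<lambda>y. x \<otimes> y" "\<lambda>y. inv x \<otimes> y"])
      (use that in \<open>auto simp: m_assoc[symmetric]\<close>)
  then show ?thesis
    using assms unfolding stochastic_matrix_def walk_matrix_def weight_function_def
    by (auto simp: sum_divide_distrib[symmetric])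
qed

lemma space_steps_measure: "space (steps_measure G w) = UNIV \<rightarrow> carrier G"
  by (simp add: steps_measure_def space_PiM space_point_measure PiE_UNIV_domain)

lemma walk_path_closed:
  "a \<in> carrier G \<Longrightarrow> s \<in> UNIV \<rightarrow> carrier G \<Longrightarrow> walk_path G a s n \<in> carrier G"
  by (induction n) auto

text \<open>By cancellation, n+1 positions amount to a starting point and n increments. This turns
  path events into cylinder events for the increments.\<close>

lemma walk_path_eq_iff:
  assumes "a \<in> carrier G" "s \<in> UNIV \<rightarrow> carrier G" "\<And>i. i \<le> n \<Longrightarrow> x i \<in> carrier G"
  shows "(\<forall>i\<le>n. walk_path G a s i = x i) \<longleftrightarrow>
    a = x 0 \<and> (\<forall>i<n. s i = inv (x i) \<otimes> x (Suc i))"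
  using assms(3)
proof (induction n)
  case (Suc n)
  have s: "s n \<in> carrier G" using assms(2) by auto
  have "x n \<otimes> s n = x (Suc n) \<longleftrightarrow> s n = inv (x n) \<otimes> x (Suc n)"
    using Suc.prems[of n] Suc.prems[of "Suc n"] s inv_solve_left by auto
  with Suc show ?case by (auto simp: le_Suc_eq less_Suc_eq)
qed auto

lemma prob_walk_path:
  assumes fin: "finite (carrier G)" and w: "weight_function G w"
    and x: "\<And>i. i \<le> n \<Longrightarrow> x i \<in> carrier G"
  shows "measure (steps_measure G w) {s \<in> space (steps_measure G w). \<forall>i\<le>n. walk_path G (x 0) s i = x i} =
    (\<Prod>i<n. walk_matrix G w (x i) (x (Suc i)))"
proof -
  let ?\<mu> = "point_measure (carrier G) (\<lambda>g. ennreal (w g / sum w (carrier G)))"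
  interpret \<mu>: prob_space ?\<mu> by (rule prob_space_steps[OF fin w])
  interpret product_prob_space "\<lambda>_. ?\<mu>" "UNIV :: nat set" by unfold_locales
  let ?E = "\<lambda>i. {inv (x i) \<otimes> x (Suc i)}"
  have c: "?E i \<subseteq> carrier G" if "i < n" for i using x that by simp
  have "{s \<in> space (steps_measure G w). \<forall>i\<le>n. walk_path G (x 0) s i = x i} =
      {s \<in> space (steps_measure G w). \<forall>i<n. s i = inv (x i) \<otimes> x (Suc i)}"
    using walk_path_eq_iff[of "x 0" _ n x] x
    by (intro Collect_cong) (simp add: space_steps_measure cong: conj_cong)
  \<comment> \<open>A cylinder with one-point sides, whose probability factorises because the
    increments are independent.\<close>
  also have "\<dots> = emb UNIV {..<n} (Pi\<^sub>E {..<n} ?E)"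
    by (auto simp: space_steps_measure prod_emb_def space_PiM space_point_measure PiE_UNIV_domain
        Pi_iff[where I = "{..<n}"])
  finally have "measure (steps_measure G w)
        {s \<in> space (steps_measure G w). \<forall>i\<le>n. walk_path G (x 0) s i = x i} =
      (\<Prod>i<n. measure ?\<mu> (?E i))"
    unfolding steps_measure_def
    using measure_PiM_emb[of "{..<n}" ?E] c by (simp add: sets_point_measure)
  also have "\<dots> = (\<Prod>i<n. walk_matrix G w (x i) (x (Suc i)))"
  proof (rule prod.cong)
    fix i assume "i \<in> {..<n}"
    then show "measure ?\<mu> (?E i) = walk_matrix G w (x i) (x (Suc i))"
      using c[of i] w fin measure_point_measure_finite_if[of "carrier G" "\<lambda>g. w g / sum w (carrier G)"]
      by (simp add: walk_matrix_def weight_function_def)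
  qed simp
  finally show ?thesis .
qed

lemma markov_chain_walk_path:
  assumes fin: "finite (carrier G)" and w: "weight_function G w" and a: "a \<in> carrier G"
  shows "markov_chain (steps_measure G w) (\<lambda>n s. walk_path G a s n) (carrier G) (walk_matrix G w)"
  unfolding markov_chain_def
proof (intro conjI allI impI)
  let ?M = "steps_measure G w"
  show "prob_space ?M"
    unfolding steps_measure_def by (intro prob_space_PiM prob_space_steps fin w)
  show "stochastic_matrix (carrier G) (walk_matrix G w)"
    by (rule stochastic_walk_matrix[OF fin w])
  show "(\<lambda>s. walk_path G a s n) \<in> measurable ?M (count_space (carrier G))" for n
  proof (induction n)
    case (Suc n)
    have s: "(\<lambda>s. s n) \<in> measurable ?M (count_space (carrier G))"
      unfolding steps_measure_def
      using measurable_component_singleton[of n UNIV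
          "\<lambda>_. point_measure (carrier G) (\<lambda>g. ennreal (w g / sum w (carrier G)))"]
      by (simp add: measurable_cong_sets[OF refl sets_point_measure_count_space])
    have "(\<lambda>s. (walk_path G a s n, s n)) \<in>
        measurable ?M (count_space (carrier G) \<Otimes>\<^sub>M count_space (carrier G))"
      using Suc s by (rule measurable_Pair)
    \<comment> \<open>Finiteness makes the product of the two discrete spaces discrete, so group
      multiplication is measurable on it.\<close>
    also have "count_space (carrier G) \<Otimes>\<^sub>M count_space (carrier G) =
        count_space (carrier G \<times> carrier G)"
      by (rule pair_measure_count_space[OF fin fin])
    finally have "(\<lambda>s. case (walk_path G a s n, s n) of (u, v) \<Rightarrow> u \<otimes> v) \<in>
        measurable ?M (count_space (carrier G))"
      by (rule measurable_compose) auto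
    then show ?case by simp
  qed (use a in simp)
  fix n x
  assume x: "\<forall>i\<le>Suc n. x i \<in> carrier G"
    and pos: "\<P>(s in ?M. \<forall>i\<le>n. walk_path G a s i = x i) > 0"
  \<comment> \<open>The start is deterministic, so a history of positive probability must begin at
    \<open>a\<close>.\<close>
  have a': "a = x 0"
  proof (rule ccontr)
    assume "a \<noteq> x 0"
    then have "{s \<in> space ?M. \<forall>i\<le>n. walk_path G a s i = x i} = {}" by force
    then show False using pos by (metis less_irrefl measure_empty)
  qed
  have "{s \<in> space ?M. walk_path G a s (Suc n) = x (Suc n) \<and> (\<forall>i\<le>n. walk_path G a s i = x i)} =
      {s \<in> space ?M. \<forall>i\<le>Suc n. walk_path G a s i = x i}"
    by (auto simp: le_Suc_eq simp del: walk_path.simps(2))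
  \<comment> \<open>The path probabilities are products over \<open>i < Suc n\<close> and
    \<open>i < n\<close>; their quotient is the last factor, the denominator being positive by
    \<open>pos\<close>.\<close>
  then show "\<P>(s in ?M. walk_path G a s (Suc n) = x (Suc n) \<bar> \<forall>i\<le>n. walk_path G a s i = x i) =
      walk_matrix G w (x n) (x (Suc n))"
    using pos prob_walk_path[OF fin w, of n x] prob_walk_path[OF fin w, of "Suc n" x] x
    unfolding cond_prob_def a' by (simp del: walk_path.simps prod_zero_iff)
qed

section \<open>Double cosets and sufficiency of the coset condition\<close>

lemma mem_double_coset_iff:
  assumes "subgroup H G" "x \<in> carrier G"
  shows "y \<in> double_coset G H x \<longleftrightarrow> (\<exists>h\<in>H. \<exists>k\<in>H. y = h \<otimes> x \<otimes> k)"
  using assms subgroup.mem_carrier[OF assms(1)]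
  by (auto simp: double_coset_def set_mult_def l_coset_def m_assoc intro!: bexI)

lemma double_coset_eqI:
  assumes H: "subgroup H G" and x: "x \<in> carrier G" and h: "h \<in> H" and k: "k \<in> H"
  shows "double_coset G H (h \<otimes> x \<otimes> k) = double_coset G H x"
proof -
  note c = subgroup.mem_carrier[OF H] and cl = subgroup.m_closed[OF H] subgroup.m_inv_closed[OF H]
  \<comment> \<open>Stated for all \<open>x\<close>, \<open>h\<close>, \<open>k\<close>, since the
    reverse inclusion is the same fact with the inverse factors applied to the translated
    element.\<close>
  have sub: "double_coset G H (h \<otimes> x \<otimes> k) \<subseteq> double_coset G H x"
    if "x \<in> carrier G" "h \<in> H" "k \<in> H" for x h k
  proof
    fix y assume "y \<in> double_coset G H (h \<otimes> x \<otimes> k)"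
    moreover have "h \<otimes> x \<otimes> k \<in> carrier G" using that c by simp
    ultimately obtain a b where ab: "a \<in> H" "b \<in> H" "y = a \<otimes> (h \<otimes> x \<otimes> k) \<otimes> b"
      using mem_double_coset_iff[OF H] by auto
    then have "y = (a \<otimes> h) \<otimes> x \<otimes> (k \<otimes> b)" using that c by (simp add: m_assoc)
    then show "y \<in> double_coset G H x"
      using that ab cl by (auto simp: mem_double_coset_iff[OF H])
  qed
  have "inv h \<otimes> (h \<otimes> x \<otimes> k) \<otimes> inv k = x"
    using x c[OF h] c[OF k] by (simp add: m_assoc inv_solve_left')
  then show ?thesis
    using sub[OF x h k] sub[of "h \<otimes> x \<otimes> k" "inv h" "inv k"] x h k c cl by auto
qed

lemma double_coset_eqE:
  assumes H: "subgroup H G" and y: "y \<in> carrier G" "x \<in> carrier G"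
    and eq: "double_coset G H x = double_coset G H y"
  obtains h k where "h \<in> H" "k \<in> H" "y = h \<otimes> x \<otimes> k"
proof -
  have "y \<in> double_coset G H y"
    using H y subgroup.one_closed[OF H] by (force simp: mem_double_coset_iff)
  then show ?thesis using that mem_double_coset_iff[OF H y(2)] unfolding eq[symmetric] by blast
qed

text \<open>Right translation by an element of \<open>H\<close> permutes \<open>D\<close>, so the
  sum may be averaged over all such translations. This avoids choosing coset representatives: each
  left coset is counted once for each of its elements, whence the factor
  \<open>card H\<close>.\<close>

lemma card_mult_sum_right_invariant:
  fixes u :: "'a \<Rightarrow> real"
  assumes H: "subgroup H G" and D: "D \<subseteq> carrier G" and a: "a \<in> carrier G"
    and inv: "\<And>y h. y \<in> D \<Longrightarrow> h \<in> H \<Longrightarrow> y \<otimes> h \<in> D"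
  shows "real (card H) * (\<Sum>y\<in>D. u (a \<otimes> y)) = (\<Sum>y\<in>D. sum u ((a \<otimes> y) <# H))"
proof -
  note c = subgroup.mem_carrier[OF H]
  have shift: "(\<Sum>y\<in>D. u (a \<otimes> y)) = (\<Sum>y\<in>D. u (a \<otimes> y \<otimes> h))" if h: "h \<in> H" for h
    by (rule sum.reindex_bij_witness[of _ "\<lambda>y. y \<otimes> h" "\<lambda>y. y \<otimes> inv h"])
      (use D h c a inv subgroup.m_inv_closed[OF H] in \<open>auto simp: m_assoc subset_iff\<close>)
  have coset: "sum u (g <# H) = (\<Sum>h\<in>H. u (g \<otimes> h))" if "g \<in> carrier G" for g
  proof -
    have "g <# H = (\<lambda>h. g \<otimes> h) ` H" by (auto simp: l_coset_def)
    moreover have "inj_on (\<lambda>h. g \<otimes> h) H" using that c by (auto simp: inj_on_def)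
    ultimately show ?thesis by (simp add: sum.reindex)
  qed
  have "real (card H) * (\<Sum>y\<in>D. u (a \<otimes> y)) = (\<Sum>h\<in>H. \<Sum>y\<in>D. u (a \<otimes> y \<otimes> h))"
    using sum.cong[OF refl shift, of H] by simp
  also have "\<dots> = (\<Sum>y\<in>D. \<Sum>h\<in>H. u (a \<otimes> y \<otimes> h))" by (rule sum.swap)
  also have "\<dots> = (\<Sum>y\<in>D. sum u ((a \<otimes> y) <# H))"
    using D a by (intro sum.cong refl coset[symmetric]) auto
  finally show ?thesis .
qed

lemma lumps_on_double_cosets_if:
  assumes fin: "finite (carrier G)" and H: "subgroup H G"
    and eq: "\<And>x y. \<lbrakk>x \<in> carrier G; y \<in> carrier G; double_coset G H x = double_coset G H y\<rbrakk> \<Longrightarrow>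
      sum w (x <# H) = sum w (y <# H)"
  shows "lumps_on_double_cosets G w H"
  unfolding lumps_on_double_cosets_def
proof (rule lumps_if_class_sums_eq)
  fix x x' t
  assume x: "x \<in> carrier G" and x': "x' \<in> carrier G"
    and xx': "double_coset G H x = double_coset G H x'"
  note c = subgroup.mem_carrier[OF H] and one = subgroup.one_closed[OF H]
    and cl = subgroup.m_inv_closed[OF H]
  obtain h k where hk: "h \<in> H" "k \<in> H" "x' = h \<otimes> x \<otimes> k"
    using double_coset_eqE[OF H x' x xx'] .
  let ?D = "{y \<in> carrier G. double_coset G H y = t}"
  \<comment> \<open>Left stability of \<open>?D\<close> is for the reindexing by \<open>h\<close>,
    right stability for the averaging over \<open>H\<close>.\<close>
  have mult: "h \<otimes> y \<in> ?D" "y \<otimes> h \<in> ?D" if "y \<in> ?D" "h \<in> H" for y h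
    using that one c double_coset_eqI[OF H, of y h \<one>] double_coset_eqI[OF H, of y \<one> h] by auto
  have "H \<noteq> {}" "finite H"
    using one subgroup.subset[OF H] fin by (auto intro: finite_subset)
  then have card: "real (card H) \<noteq> 0" by simp
  have "real (card H) * (\<Sum>y\<in>?D. w (inv x' \<otimes> y)) = (\<Sum>y\<in>?D. sum w ((inv x' \<otimes> y) <# H))"
    using mult x' by (intro card_mult_sum_right_invariant[OF H]) auto
  also have "\<dots> = (\<Sum>y\<in>?D. sum w ((inv x \<otimes> y) <# H))"
  \<comment> \<open>The substitution of \<open>inv h \<otimes> y\<close> for \<open>y\<close>
    absorbs \<open>h\<close>. What remains of the passage from \<open>x\<close> to \<open>x'\<close>
    is a left factor \<open>inv k\<close>, which stays within the double coset, so the weights agree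
    term by term by \<open>eq\<close>.\<close>
  proof (rule sum.reindex_bij_witness[of _ "\<lambda>y. h \<otimes> y" "\<lambda>y. inv h \<otimes> y"])
    fix y assume y: "y \<in> ?D"
    \<comment> \<open>The trailing unit only brings the product into the two-sided form of
      \<open>double_coset_eqI\<close>.\<close>
    have "inv x' \<otimes> y = inv k \<otimes> (inv x \<otimes> (inv h \<otimes> y)) \<otimes> \<one>"
      using x y hk c by (simp add: inv_mult_group m_assoc)
    then have "double_coset G H (inv x' \<otimes> y) = double_coset G H (inv x \<otimes> (inv h \<otimes> y))"
      using double_coset_eqI[OF H _ cl[OF hk(2)] one, of "inv x \<otimes> (inv h \<otimes> y)"] x y hk c by simp
    then show "sum w ((inv x \<otimes> (inv h \<otimes> y)) <# H) = sum w ((inv x' \<otimes> y) <# H)"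
      using eq x x' y hk c by simp
    show "h \<otimes> (inv h \<otimes> y) = y" using y hk c by (simp add: m_assoc[symmetric])
    show "inv h \<otimes> y \<in> ?D" using mult(1)[OF y cl[OF hk(1)]] .
  next
    fix y assume y: "y \<in> ?D"
    show "inv h \<otimes> (h \<otimes> y) = y" using y hk c by (simp add: m_assoc[symmetric])
    show "h \<otimes> y \<in> ?D" using mult(1)[OF y hk(1)] .
  qed
  also have "\<dots> = real (card H) * (\<Sum>y\<in>?D. w (inv x \<otimes> y))"
    using mult x by (intro card_mult_sum_right_invariant[OF H, symmetric]) auto
  finally have "(\<Sum>y\<in>?D. w (inv x' \<otimes> y)) = (\<Sum>y\<in>?D. w (inv x \<otimes> y))" using card by simp
  then show "(\<Sum>y\<in>?D. walk_matrix G w x y) = (\<Sum>y\<in>?D. walk_matrix G w x' y)"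
    by (simp add: walk_matrix_def sum_divide_distrib[symmetric])
qed

section \<open>Necessity: coset weights read off from one step into \<open>H\<close>\<close>

lemma double_coset_eq_one_iff:
  assumes H: "subgroup H G" and y: "y \<in> carrier G"
  shows "double_coset G H y = double_coset G H \<one> \<longleftrightarrow> y \<in> H"
proof
  note c = subgroup.mem_carrier[OF H] and one = subgroup.one_closed[OF H]
  assume "double_coset G H y = double_coset G H \<one>"
  then obtain h k where "h \<in> H" "k \<in> H" "y = h \<otimes> \<one> \<otimes> k"
    using double_coset_eqE[OF H y one_closed] by metis
  then show "y \<in> H" using c subgroup.m_closed[OF H] by simp
next
  assume "y \<in> H"
  then show "double_coset G H y = double_coset G H \<one>"
    using double_coset_eqI[OF H one_closed _ subgroup.one_closed[OF H], of y]
      subgroup.mem_carrier[OF H] by simp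
qed

lemma prob_walk_to_subgroup:
  assumes fin: "finite (carrier G)" and w: "weight_function G w" and H: "subgroup H G"
    and a: "a \<in> carrier G"
  shows "\<P>(s in steps_measure G w. walk_path G a s 1 \<in> H) = sum w (inv a <# H) / sum w (carrier G)"
proof -
  let ?\<mu> = "point_measure (carrier G) (\<lambda>g. ennreal (w g / sum w (carrier G)))"
  interpret \<mu>: prob_space ?\<mu> by (rule prob_space_steps[OF fin w])
  interpret product_prob_space "\<lambda>_. ?\<mu>" "UNIV :: nat set" by unfold_locales
  have sub: "inv a <# H \<subseteq> carrier G"
    using a subgroup.subset[OF H] by (intro l_coset_subset_G) auto
  have iff: "a \<otimes> g \<in> H \<longleftrightarrow> g \<in> inv a <# H" if "g \<in> carrier G" for g
  proof
    assume "a \<otimes> g \<in> H"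
    then show "g \<in> inv a <# H"
      using a that by (auto simp: l_coset_def m_assoc[symmetric] intro!: bexI[of _ "a \<otimes> g"])
  next
    assume "g \<in> inv a <# H"
    then show "a \<otimes> g \<in> H"
      using a subgroup.mem_carrier[OF H] by (auto simp: l_coset_def m_assoc[symmetric])
  qed
  \<comment> \<open>The position at time 1 involves the increment with index 0 only, so this is a
    cylinder over one coordinate.\<close>
  have "{s \<in> space (steps_measure G w). walk_path G a s 1 \<in> H} =
      emb UNIV {..<1} (Pi\<^sub>E {..<1} (\<lambda>_. inv a <# H))"
    using iff
    by (auto simp: space_steps_measure prod_emb_def space_PiM space_point_measure PiE_UNIV_domain
        Pi_iff)
  then have "\<P>(s in steps_measure G w. walk_path G a s 1 \<in> H) = measure ?\<mu> (inv a <# H)"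
    unfolding steps_measure_def
    using measure_PiM_emb[of "{..<1}" "\<lambda>_. inv a <# H"] sub by (simp add: sets_point_measure)
  also have "\<dots> = sum w (inv a <# H) / sum w (carrier G)"
    using sub w fin measure_point_measure_finite_if[of "carrier G" "\<lambda>g. w g / sum w (carrier G)"]
    by (simp add: weight_function_def sum_divide_distrib)
  finally show ?thesis .
qed

text \<open>Lumping provides one \<open>Q\<close> for all starting points, so walks started at two
  points of the same double coset enter \<open>H\<close> in one step with equal probability. From
  \<open>a\<close> this probability shows the weight of the coset of \<open>inv a\<close>, so the
  walks to compare start at \<open>inv x\<close> and \<open>inv y\<close>.\<close>

lemma sum_coset_eq_if_lumps:
  assumes fin: "finite (carrier G)" and w: "weight_function G w" and H: "subgroup H G"
    and lumps: "lumps_on_double_cosets G w H"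
    and x: "x \<in> carrier G" and y: "y \<in> carrier G"
    and eq: "double_coset G H x = double_coset G H y"
  shows "sum w (x <# H) = sum w (y <# H)"
proof -
  let ?M = "steps_measure G w" and ?D = "double_coset G H"
  obtain Q where Q: "\<And>M :: (nat \<Rightarrow> 'a) measure. \<And>X. markov_chain M X (carrier G) (walk_matrix G w) \<Longrightarrow>
      markov_chain M (\<lambda>n \<omega>. ?D (X n \<omega>)) (?D ` carrier G) Q"
    using lumps unfolding lumps_on_double_cosets_def lumps_def by blast
  have Q': "sum w (inv a <# H) / sum w (carrier G) = Q (?D a) (?D \<one>)" if a: "a \<in> carrier G" for a
  proof -
    have chain: "markov_chain ?M (\<lambda>n s. ?D (walk_path G a s n)) (?D ` carrier G) Q"
      by (rule Q[OF markov_chain_walk_path[OF fin w a]])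
    then interpret prob_space ?M by (simp add: markov_chain_def)
    \<comment> \<open>The class path from that of \<open>a\<close> to \<open>H\<close>, of which
      only times 0 and 1 matter. Its time-0 event has probability 1 by the deterministic start, so
      its full probability is the entry of \<open>Q\<close>.\<close>
    have "(if i = 0 then ?D a else ?D \<one>) \<in> ?D ` carrier G" for i :: nat using a by auto
    from markov_chain_prob_path_Suc[OF chain, of 0 "\<lambda>i. if i = 0 then ?D a else ?D \<one>", OF this]
    have "Q (?D a) (?D \<one>) = \<P>(s in ?M. \<forall>i\<le>Suc 0. ?D (walk_path G a s i) = (if i = 0 then ?D a else ?D \<one>))"
      by (simp add: prob_space del: walk_path.simps(2))
    also have "{s \<in> space ?M. \<forall>i\<le>Suc 0. ?D (walk_path G a s i) = (if i = 0 then ?D a else ?D \<one>)} =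
        {s \<in> space ?M. walk_path G a s 1 \<in> H}"
      using walk_path_closed[OF a, of _ 1] double_coset_eq_one_iff[OF H]
      by (auto simp: le_Suc_eq space_steps_measure simp del: walk_path.simps(2))
    finally show ?thesis using prob_walk_to_subgroup[OF fin w H a] by simp
  qed
  obtain h k where hk: "h \<in> H" "k \<in> H" "y = h \<otimes> x \<otimes> k" using double_coset_eqE[OF H y x eq] .
  \<comment> \<open>Inversion carries double cosets to double cosets, with the outer factors
    inverted and swapped.\<close>
  then have "inv y = inv k \<otimes> inv x \<otimes> inv h"
    using x subgroup.mem_carrier[OF H] by (simp add: inv_mult_group m_assoc)
  then have "?D (inv y) = ?D (inv x)"
    using double_coset_eqI[OF H inv_closed[OF x]] subgroup.m_inv_closed[OF H] hk by simp
  then have "sum w (x <# H) / sum w (carrier G) = sum w (y <# H) / sum w (carrier G)"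
    using Q'[of "inv x"] Q'[of "inv y"] x y by simp
  then show ?thesis using w by (simp add: weight_function_def)
qed

end

theorem corollary1p2:
  fixes G :: "('a, 'b) monoid_scheme" and w :: "'a \<Rightarrow> real" and H :: "'a set"
  assumes "group G" and "finite (carrier G)"
    and "weight_function G w"
    and "subgroup H G"
  shows "lumps_on_double_cosets G w H \<longleftrightarrow>
    (\<forall>x\<in>carrier G. \<forall>y\<in>carrier G. double_coset G H x = double_coset G H y \<longrightarrow>
       sum w (x <#\<^bsub>G\<^esub> H) = sum w (y <#\<^bsub>G\<^esub> H))"
  using group.lumps_on_double_cosets_if[OF assms(1,2,4)] group.sum_coset_eq_if_lumps[OF assms]
  by blast

end
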